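(* There exists $N_0\in \mathbb{N}$ such that for all integers $a\geq 2$ and all $n\geq N_0$, \[\mathrm{ex}_{\Pi}\Bigl(n, 7, \tbinom{7}{2}a +9\Bigr) = \Pi_{2,1}(a,n).\]
   Context: A multigraph is a pair $G=(V,w)$ where $V$ is a finite set and $w:\binom{V}{2}\to\mathbb{Z}_{\geq 0}$. For $X\subseteq V$ write $e(G[X])=\sum_{xy\in\binom{X}{2}}w(xy)$ and $P(G)=\prod_{xy\in\binom{V}{2}}w(xy)$. Given integers $s\geq 2$, $q\geq 0$, $\mathcal{F}(n,s,q)$ denotes the set of multigraphs on vertex set $[n]=\{1,\dots,n\}$ in which every $s$-set $X$ of vertices satisfies $e(G[X])\leq q$, and $\mathrm{ex}_{\Pi}(n,s,q)=\max\{P(G): G\in\mathcal{F}(n,s,q)\}$. For positive integers $a,r$, $d\in\{0,\dots,a-1\}$ and $n$, $\mathcal{T}_{r,d}(a,n)$ is the set of multigraphs $G$ on $[n]$ whose vertex set can be partitioned into $r$ parts $V_0,\dots,V_{r-1}$ such that all pairs inside $V_0$ have multiplicity $a-d$, all pairs inside $V_i$ ($1\le i\le r-1$) have multiplicity $a$, and all other pairs have multiplicity $a+1$. $\Pi_{r,d}(a,n)=\max\{P(G):G\in\mathcal{T}_{r,d}(a,n)\}$. *)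

theory Defs
  imports Main "HOL-Library.FuncSet" "HOL-Library.Disjoint_Sets" "HOL-Library.Ramsey"
begin

text \<open>
  A multigraph is a pair \<open>(V, w)\<close>, with \<open>w\<close> defined on the two-element subsets of \<open>V\<close> and
  \<open>undefined\<close> elsewhere.
\<close>

type_synonym 'a multigraph = "'a set \<times> ('a set \<Rightarrow> nat)"

definition multigraph :: "'a multigraph \<Rightarrow> bool" where
  "multigraph G \<longleftrightarrow> (case G of (V, w) \<Rightarrow> finite V \<and> w \<in> nsets V 2 \<rightarrow>\<^sub>E UNIV)"

definition edge_sum :: "'a multigraph \<Rightarrow> 'a set \<Rightarrow> nat" where
  "edge_sum G X = (case G of (V, w) \<Rightarrow> (\<Sum>e\<in>nsets X 2. w e))"

definition edge_prod :: "'a multigraph \<Rightarrow> nat" where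
  "edge_prod G = (case G of (V, w) \<Rightarrow> (\<Prod>e\<in>nsets V 2. w e))"

definition sq_graphs :: "nat \<Rightarrow> nat \<Rightarrow> nat \<Rightarrow> nat multigraph set" where
  "sq_graphs n s q =
    {G. multigraph G \<and> fst G = {1..n} \<and> (\<forall>X\<in>nsets {1..n} s. edge_sum G X \<le> q)}"

text \<open>
  For \<open>s \<ge> 2\<close> and \<open>n \<ge> s\<close> every multiplicity is at most \<open>q\<close>, so the maximum is over a finite
  nonempty set; for smaller \<open>n\<close> it need not exist.
\<close>

definition ex_prod :: "nat \<Rightarrow> nat \<Rightarrow> nat \<Rightarrow> nat" where
  "ex_prod n s q = Max (edge_prod ` sq_graphs n s q)"

text \<open>
  Parts may be empty, so that the family is nonempty for all \<open>n\<close> (including \<open>n < r\<close>). The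
  subtraction \<open>a - d\<close> is meant for \<open>d < a\<close>.
\<close>

definition turan_graphs :: "nat \<Rightarrow> nat \<Rightarrow> nat \<Rightarrow> nat \<Rightarrow> nat multigraph set" where
  "turan_graphs r d a n =
    {G. multigraph G \<and> fst G = {1..n} \<and>
      (\<exists>V :: nat \<Rightarrow> nat set.
        disjoint_family_on V {..<r} \<and> (\<Union>i<r. V i) = {1..n} \<and>
        (\<forall>e\<in>nsets (V 0) 2. snd G e = a - d) \<and>
        (\<forall>i\<in>{1..<r}. \<forall>e\<in>nsets (V i) 2. snd G e = a) \<and>
        (\<forall>e\<in>nsets {1..n} 2. (\<forall>i<r. \<not> e \<subseteq> V i) \<longrightarrow> snd G e = a + 1))}"

definition turan_prod :: "nat \<Rightarrow> nat \<Rightarrow> nat \<Rightarrow> nat \<Rightarrow> nat" where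
  "turan_prod r d a n = Max (edge_prod ` turan_graphs r d a n)"

end

theory Submission imports Defs Complex_Main begin

text \<open>
  Write \<open>w = a + x\<close>. Since \<open>1 + x/a \<le> (1 + 1/a)^x\<close> for all integers \<open>x \<ge> -a\<close>, the product over
  the pairs meeting a set \<open>S\<close> is controlled by the sum of \<open>x\<close> over these pairs. If this sum is
  small for some \<open>S\<close> with 2 to 6 vertices, then deleting \<open>S\<close> and induction on \<open>n\<close> win a factor
  exponential in \<open>n/a\<close>. Otherwise the bound 9 on 7-sets yields successively the bounds
  7, 5, 3, 2, 1 on sets of size 6, 5, 4, 3, 2, and a short analysis of the graph of pairs with
  \<open>x = 1\<close> shows that \<open>w\<close> is pointwise at most a weighting of Turan type. As every gain and loss
  is a power of \<open>1 + 1/a\<close>, the threshold on \<open>n\<close> does not depend on \<open>a\<close>.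
\<close>

section \<open>Sums and products over pairs\<close>

definition pair_sum :: "('a set \<Rightarrow> int) \<Rightarrow> 'a set \<Rightarrow> int" where
  "pair_sum x X = (\<Sum>e\<in>nsets X 2. x e)"

lemma nsets_two_insert:
  assumes "z \<notin> X"
  shows "nsets (insert z X) 2 = nsets X 2 \<union> (\<lambda>y. {z, y}) ` X"
proof
  show "nsets (insert z X) 2 \<subseteq> nsets X 2 \<union> (\<lambda>y. {z, y}) ` X"
    by (fastforce elim!: nsets2_E simp: doubleton_in_nsets_2)
  show "nsets X 2 \<union> (\<lambda>y. {z, y}) ` X \<subseteq> nsets (insert z X) 2"
    using assms by (fastforce elim!: nsets2_E simp: doubleton_in_nsets_2)
qed

lemma pair_sum_insert:
  assumes "finite X" "z \<notin> X"
  shows "pair_sum x (insert z X) = pair_sum x X + (\<Sum>y\<in>X. x {z, y})"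
proof -
  have "nsets X 2 \<inter> (\<lambda>y. {z, y}) ` X = {}"
    using assms by (auto simp: nsets_def)
  moreover have "inj_on (\<lambda>y. {z, y}) X"
    by (auto simp: inj_on_def doubleton_eq_iff)
  ultimately show ?thesis
    unfolding pair_sum_def nsets_two_insert[OF assms(2)]
    using assms by (simp add: sum.union_disjoint finite_imp_finite_nsets sum.reindex)
qed

lemma pair_sum_empty [simp]: "pair_sum x {} = 0"
  by (simp add: pair_sum_def nsets_def conj_commute cong: conj_cong)

lemma pair_sum_union_le:
  assumes "finite W" "finite S" "W \<inter> S = {}" "\<And>z. z \<in> W \<Longrightarrow> (\<Sum>y\<in>S. x {z, y}) \<le> \<delta>"
  shows "pair_sum x (W \<union> S) \<le> pair_sum x W + pair_sum x S + \<delta> * int (card W)"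
  using assms
proof (induction W rule: finite_induct)
  case (insert z W)
  have "(\<Sum>y\<in>W \<union> S. x {z, y}) = (\<Sum>y\<in>W. x {z, y}) + (\<Sum>y\<in>S. x {z, y})"
    using insert.prems insert.hyps by (intro sum.union_disjoint) auto
  moreover have "pair_sum x (W \<union> S) \<le> pair_sum x W + pair_sum x S + \<delta> * int (card W)"
    using insert by auto
  moreover have "(\<Sum>y\<in>S. x {z, y}) \<le> \<delta>"
    using insert.prems by auto
  moreover have "z \<notin> S" using insert.prems by auto
  ultimately show ?case
    using insert.hyps insert.prems(1) by (simp add: pair_sum_insert distrib_left)
qed simp

text \<open>Double counting: a pair survives the deletion of \<open>v\<close> unless
  \<open>v\<close> is one of its two ends.\<close>

lemma sum_pair_sum_remove:
  assumes "finite V"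
  shows "(\<Sum>v\<in>V. pair_sum x (V - {v})) = (int (card V) - 2) * pair_sum x V"
proof -
  have "(\<Sum>v\<in>V. pair_sum x (V - {v}))
      = (\<Sum>v\<in>V. \<Sum>e\<in>nsets V 2. if v \<in> e then 0 else x e)"
  proof (rule sum.cong[OF refl])
    fix v
    have "nsets (V - {v}) 2 = {e \<in> nsets V 2. v \<notin> e}"
      by (auto simp: nsets_def)
    then show "pair_sum x (V - {v}) = (\<Sum>e\<in>nsets V 2. if v \<in> e then 0 else x e)"
      unfolding pair_sum_def using finite_imp_finite_nsets[OF assms]
      by (simp add: sum.inter_filter[symmetric] if_distrib cong: if_cong)
        (intro sum.mono_neutral_cong_left, auto)
  qed
  also have "\<dots> = (\<Sum>e\<in>nsets V 2. \<Sum>v\<in>V. if v \<in> e then 0 else x e)"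
    by (rule sum.swap)
  also have "\<dots> = (\<Sum>e\<in>nsets V 2. (int (card V) - 2) * x e)"
  proof (rule sum.cong[OF refl])
    fix e assume e: "e \<in> nsets V 2"
    have "(\<Sum>v\<in>V. if v \<in> e then 0 else x e) = (\<Sum>v\<in>V - e. x e)"
      using assms by (intro sum.mono_neutral_cong_right) auto
    also have "\<dots> = int (card (V - e)) * x e"
      by simp
    also have "int (card (V - e)) = int (card V) - 2"
    proof -
      have "e \<subseteq> V" "finite e" "card e = 2"
        using e by (auto simp: nsets_def)
      then show ?thesis
        using card_mono[OF assms \<open>e \<subseteq> V\<close>] by (simp add: card_Diff_subset)
    qed
    finally show "(\<Sum>v\<in>V. if v \<in> e then 0 else x e) = (int (card V) - 2) * x e" .
  qed
  finally show ?thesis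
    by (simp add: pair_sum_def sum_distrib_left)
qed

text \<open>Nine units on the 21 pairs of a 7-set mean density 3/7, and averaging over vertex
  deletions carries this density to all larger sets. This is the crude bound for small vertex
  sets.\<close>

lemma pair_sum_le_average:
  assumes "finite V" "card V \<ge> 7" "\<And>X. X \<subseteq> V \<Longrightarrow> card X = 7 \<Longrightarrow> pair_sum x X \<le> 9"
  shows "14 * pair_sum x V \<le> 3 * int (card V) * (int (card V) - 1)"
  using assms
proof (induction "card V" arbitrary: V rule: less_induct)
  case less
  show ?case
  proof (cases "card V = 7")
    case True
    then show ?thesis using less.prems(3)[of V] by simp
  next
    case False
    define n where "n = int (card V)"
    have n: "n \<ge> 8" using False less.prems(2) by (simp add: n_def)
    have "14 * pair_sum x (V - {v}) \<le> 3 * (n - 1) * (n - 2)" if v: "v \<in> V" for v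
    proof -
      have c: "int (card (V - {v})) = n - 1" "card (V - {v}) < card V" "card (V - {v}) \<ge> 7"
        using v less.prems False by (auto simp: n_def card_gt_0_iff)
      have "14 * pair_sum x (V - {v}) \<le> 3 * int (card (V - {v})) * (int (card (V - {v})) - 1)"
        by (rule less.hyps) (use less.prems c in auto)
      then show ?thesis unfolding c(1) by simp
    qed
    then have "(\<Sum>v\<in>V. 14 * pair_sum x (V - {v})) \<le> (\<Sum>v\<in>V. 3 * (n - 1) * (n - 2))"
      by (rule sum_mono)
    then have "14 * ((n - 2) * pair_sum x V) \<le> n * (3 * (n - 1) * (n - 2))"
      using sum_pair_sum_remove[OF less.prems(1), of x]
      by (simp add: sum_distrib_left[symmetric] n_def)
    then have "(n - 2) * (14 * pair_sum x V) \<le> (n - 2) * (3 * n * (n - 1))"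
      by (simp add: algebra_simps)
    then show ?thesis
      using n unfolding n_def[symmetric] by (simp only: mult_le_cancel_left)
  qed
qed

lemma nsets_two_partition:
  assumes "A \<inter> B = {}"
  shows "nsets (A \<union> B) 2 = nsets A 2 \<union> nsets B 2 \<union> (\<lambda>(u, v). {u, v}) ` (A \<times> B)"
    (is "?L = ?R")
proof
  show "?L \<subseteq> ?R"
    by (fastforce elim!: nsets2_E simp: doubleton_in_nsets_2 insert_commute)
  show "?R \<subseteq> ?L"
    using assms by (fastforce elim!: nsets2_E simp: doubleton_in_nsets_2)
qed

text \<open>Stated for commutative monoids so that it splits both sums and products.\<close>

lemma (in comm_monoid_set) nsets_two_partition:
  assumes "finite A" "finite B" "A \<inter> B = {}"
  shows "F g (nsets (A \<union> B) 2)
    = F g (nsets A 2) \<^bold>* F g (nsets B 2) \<^bold>* F (\<lambda>(u, v). g {u, v}) (A \<times> B)"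
proof -
  have inj: "inj_on (\<lambda>(u, v). {u, v}) (A \<times> B)"
    using assms(3) by (auto simp: inj_on_def doubleton_eq_iff)
  have "nsets A 2 \<inter> nsets B 2 = {}"
    using assms(3) by (fastforce elim!: nsets2_E simp: doubleton_eq_iff)
  moreover have "(nsets A 2 \<union> nsets B 2) \<inter> (\<lambda>(u, v). {u, v}) ` (A \<times> B) = {}"
    using assms(3) by (fastforce simp: doubleton_in_nsets_2)
  ultimately show ?thesis
    unfolding Submission.nsets_two_partition[OF assms(3)]
    using assms reindex[OF inj, of g]
    by (simp add: union_disjoint finite_imp_finite_nsets case_prod_unfold o_def)
qed

lemma card_nsets_two: "finite A \<Longrightarrow> card (nsets A 2) = card A choose 2"
  by (simp add: card_nsets)

section \<open>Weightings without a removable set\<close>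

text \<open>
  The last three assumptions say that no small vertex set receives little weight from every
  other vertex. They force the pairs of weight 1 to form a bipartite graph whose one side,
  the set of centres of paths \<open>v - u - y\<close> with \<open>f v y = 0\<close>, carries only negative weights.
\<close>

locale tight_weighting =
  fixes V :: "'a set" and f :: "'a \<Rightarrow> 'a \<Rightarrow> int"
  assumes sym: "f u v = f v u"
    and pair_le: "\<lbrakk>{u, v} \<subseteq> V; distinct [u, v]\<rbrakk> \<Longrightarrow> f u v \<le> 1"
    and triple_le: "\<lbrakk>{u, v, w} \<subseteq> V; distinct [u, v, w]\<rbrakk> \<Longrightarrow> f u v + f u w + f v w \<le> 2"
    and quad_le: "\<lbrakk>{u, v, w, y} \<subseteq> V; distinct [u, v, w, y]\<rbrakk>
      \<Longrightarrow> f u v + f u w + f u y + f v w + f v y + f w y \<le> 3"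
    and pair_gets: "\<lbrakk>{u, v} \<subseteq> V; distinct [u, v]\<rbrakk>
      \<Longrightarrow> \<exists>z\<in>V. z \<notin> {u, v} \<and> f u z + f v z \<ge> 1"
    and quad_gets: "\<lbrakk>{u, v, w, y} \<subseteq> V; distinct [u, v, w, y]\<rbrakk>
      \<Longrightarrow> \<exists>z\<in>V. z \<notin> {u, v, w, y} \<and> f u z + f v z + f w z + f y z \<ge> 2"
    and quint_gets: "\<lbrakk>{u, v, w, y, t} \<subseteq> V; distinct [u, v, w, y, t]\<rbrakk>
      \<Longrightarrow> \<exists>z\<in>V. z \<notin> {u, v, w, y, t} \<and> f u z + f v z + f w z + f y z + f t z \<ge> 2"
begin

definition edge_centre :: "'a \<Rightarrow> 'a \<Rightarrow> bool" where
  "edge_centre u v \<longleftrightarrow> u \<in> V \<and> v \<in> V \<and> u \<noteq> v \<and> f u v = 1 \<and>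
    (\<exists>y\<in>V. y \<noteq> u \<and> y \<noteq> v \<and> f u y = 1 \<and> f v y = 0)"

text \<open>The triples \<open>a b c\<close> and \<open>b c d\<close> already weigh 2, so by
  \<open>quad_le\<close> each gets at most 1 from \<open>z\<close>. The 2 demanded by
  \<open>quad_gets\<close> must then come from the ends \<open>a\<close> and \<open>d\<close>, and
  \<open>triple_le\<close> forces the zeros. A 5-cycle arises, with \<open>f a d\<close> still
  open.\<close>

lemma path_closes_to_cycle:
  assumes V: "{a, b, c, d} \<subseteq> V" "distinct [a, b, c, d]"
    and "f a b = 1" "f b c = 1" "f c d = 1" "f a c = 0" "f b d = 0"
  obtains z where "z \<in> V" "z \<notin> {a, b, c, d}" "f a z = 1" "f b z = 0" "f c z = 0" "f d z = 1"
proof -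
  obtain z where z: "z \<in> V" "z \<notin> {a, b, c, d}" and ge: "f a z + f b z + f c z + f d z \<ge> 2"
    using quad_gets[OF V] by blast
  have "f a z \<le> 1" "f d z \<le> 1" using V z pair_le by auto
  moreover have "f a b + f a c + f a z + f b c + f b z + f c z \<le> 3"
    using V z by (intro quad_le) auto
  moreover have "f b c + f b d + f b z + f c d + f c z + f d z \<le> 3"
    using V z by (intro quad_le) auto
  moreover have "f a b + f a z + f b z \<le> 2" "f c d + f c z + f d z \<le> 2"
    using V z by (intro triple_le; auto)+
  ultimately have "f a z = 1" "f b z = 0" "f c z = 0" "f d z = 1"
    using ge assms(3-) by linarith+
  then show thesis using that z by blast
qed

text \<open>With \<open>f a d = 0\<close>, all five 3-vertex paths along the 5-cycle weigh 2, so
  each gets at most 1 from \<open>y\<close>. Every vertex lies on three of them, so three times the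
  total from \<open>y\<close> is at most 5, against the 2 demanded by
  \<open>quint_gets\<close>.\<close>

lemma no_exact_path:
  assumes V: "{a, b, c, d} \<subseteq> V" "distinct [a, b, c, d]"
    and "f a b = 1" "f b c = 1" "f c d = 1" "f a c = 0" "f b d = 0" "f a d = 0"
  shows False
proof -
  obtain z where z: "z \<in> V" "z \<notin> {a, b, c, d}"
    and fz: "f a z = 1" "f b z = 0" "f c z = 0" "f d z = 1"
    using path_closes_to_cycle assms by metis
  have V5: "{a, b, c, d, z} \<subseteq> V" "distinct [a, b, c, d, z]"
    using V z by auto
  obtain y where y: "y \<in> V" "y \<notin> {a, b, c, d, z}"
    and ge: "f a y + f b y + f c y + f d y + f z y \<ge> 2"
    using quint_gets[OF V5] by blast
  have "f a b + f a c + f a y + f b c + f b y + f c y \<le> 3"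
    "f b c + f b d + f b y + f c d + f c y + f d y \<le> 3"
    "f c d + f c z + f c y + f d z + f d y + f z y \<le> 3"
    "f a d + f a z + f a y + f d z + f d y + f z y \<le> 3"
    "f a b + f a z + f a y + f b z + f b y + f z y \<le> 3"
    using V5 y by (intro quad_le; auto)+
  then show False using ge assms(3-) fz by linarith
qed

lemma no_path:
  assumes V: "{a, b, c, d} \<subseteq> V" "distinct [a, b, c, d]"
    and "f a b = 1" "f b c = 1" "f c d = 1" "f a c = 0" "f b d = 0"
  shows False
proof -
  obtain z where z: "z \<in> V" "z \<notin> {a, b, c, d}"
    and fz: "f a z = 1" "f b z = 0" "f c z = 0" "f d z = 1"
    using path_closes_to_cycle assms by metis
  \<comment> \<open>The pair \<open>a d\<close> is not controlled, but the rotated path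
    \<open>z a b c\<close> of the 5-cycle has end pair \<open>z c\<close> of weight 0.\<close>
  show False
    by (rule no_exact_path[of z a b c]) (use V z fz assms(3-) sym in auto)
qed

text \<open>The vertex from \<open>pair_gets\<close> can by \<open>triple_le\<close> give only one
  unit to the two ends, so it gives 1 to one of them, the centre, and 0 to the other.\<close>

lemma edge_has_centre:
  assumes "u \<in> V" "v \<in> V" "u \<noteq> v" "f u v = 1"
  shows "edge_centre u v \<or> edge_centre v u"
proof -
  obtain z where z: "z \<in> V" "z \<notin> {u, v}" "f u z + f v z \<ge> 1"
    using pair_gets[of u v] assms by auto
  have "f u z \<le> 1" "f v z \<le> 1" using assms z pair_le by auto
  moreover have "f u v + f u z + f v z \<le> 2" using assms z by (intro triple_le) auto
  ultimately have "f u z = 1 \<and> f v z = 0 \<or> f u z = 0 \<and> f v z = 1"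
    using z assms by linarith
  then show ?thesis unfolding edge_centre_def using assms z sym by auto
qed

text \<open>The two witnesses would extend the edge to a path \<open>y u v y'\<close> excluded by
  \<open>no_path\<close>.\<close>

lemma edge_centre_asym:
  assumes "edge_centre u v" "edge_centre v u"
  shows False
proof -
  obtain y y' where "y \<in> V" "y \<noteq> u" "y \<noteq> v" "f u y = 1" "f v y = 0"
    "y' \<in> V" "y' \<noteq> u" "y' \<noteq> v" "f v y' = 1" "f u y' = 0"
    using assms unfolding edge_centre_def by blast
  then show False
    using assms sym by (intro no_path[of y u v y']) (auto simp: edge_centre_def)
qed

text \<open>This is where weights drop to -1: \<open>triple_le\<close> gives
  \<open>f u z <= 0\<close>, and equality would make \<open>z v u y\<close> a forbidden path,
  \<open>y\<close> being the witness for the centre \<open>u\<close>.\<close>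

lemma second_neighbour_negative:
  assumes c: "edge_centre u v" and z: "z \<in> V" "z \<noteq> u" "z \<noteq> v" "f v z = 1"
  shows "f u z \<le> -1"
proof -
  obtain y where y: "y \<in> V" "y \<noteq> u" "y \<noteq> v" "f u y = 1" "f v y = 0"
    using c unfolding edge_centre_def by blast
  have uv: "u \<in> V" "v \<in> V" "u \<noteq> v" "f u v = 1"
    using c unfolding edge_centre_def by auto
  have "f u v + f u z + f v z \<le> 2" using uv z by (intro triple_le) auto
  then have "f u z \<le> 0" using uv z by linarith
  moreover have "f u z \<noteq> 0"
  proof
    assume "f u z = 0"
    then show False
      using y uv z sym by (intro no_path[of z v u y]) auto
  qed
  ultimately show ?thesis by linarith
qed

text \<open>\<open>quad_gets\<close> fails on the path \<open>t w u v\<close>: as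
  \<open>t w u\<close> weighs 2, it gets at most 1 from \<open>z\<close>, so \<open>v\<close> gets
  1. Then \<open>u\<close> gets at most -1 by \<open>second_neighbour_negative\<close>, and
  \<open>t\<close> and \<open>w\<close> would need 2 together, though \<open>f w t = 1\<close>
  leaves them at most 1.\<close>

lemma centre_not_leaf:
  assumes uv: "edge_centre u v" and wu: "edge_centre w u"
  shows False
proof -
  have V: "u \<in> V" "v \<in> V" "w \<in> V" "u \<noteq> v" "w \<noteq> u" and f1: "f u v = 1" "f w u = 1"
    using assms unfolding edge_centre_def by auto
  have "w \<noteq> v" using assms edge_centre_asym by blast
  obtain t where t: "t \<in> V" "t \<noteq> w" "t \<noteq> u" "f w t = 1" "f u t = 0"
    using wu unfolding edge_centre_def by blast
  have "t \<noteq> v" using t f1 by auto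
  have wt: "edge_centre w t"
    unfolding edge_centre_def using V t f1 sym by metis
  have S: "{t, w, u, v} \<subseteq> V" "distinct [t, w, u, v]"
    using V t \<open>w \<noteq> v\<close> \<open>t \<noteq> v\<close> by auto
  obtain z where z: "z \<in> V" "z \<notin> {t, w, u, v}" and ge: "f t z + f w z + f u z + f v z \<ge> 2"
    using quad_gets[OF S] by blast
  have "f t z \<le> 1" "f w z \<le> 1" "f u z \<le> 1" "f v z \<le> 1"
    using S z pair_le by auto
  moreover have "f u z = 1 \<Longrightarrow> f w z \<le> -1"
    using second_neighbour_negative[OF wu] z by auto
  moreover have "f v z = 1 \<Longrightarrow> f u z \<le> -1"
    using second_neighbour_negative[OF uv] z by auto
  moreover have "f t z = 1 \<Longrightarrow> f w z \<le> -1"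
    using second_neighbour_negative[OF wt] z by auto
  moreover have "f u w + f u t + f u z + f w t + f w z + f t z \<le> 3"
    using S z by (intro quad_le) auto
  moreover have "f w t + f w z + f t z \<le> 2"
    using S z by (intro triple_le) auto
  ultimately show False
    using ge t f1 sym[of u w] by linarith
qed

text \<open>\<open>V\<^sub>0\<close> is the set of centres. Outside it a pair of weight 1 would have
  a centre; inside it such a pair would make a centre a leaf. Excluding weight 0 between two centres
  is the main work.\<close>

lemma turan_pattern:
  obtains V\<^sub>0 where "V\<^sub>0 \<subseteq> V"
    "\<And>u v. \<lbrakk>u \<in> V\<^sub>0; v \<in> V\<^sub>0; u \<noteq> v\<rbrakk> \<Longrightarrow> f u v \<le> -1"
    "\<And>u v. \<lbrakk>u \<in> V - V\<^sub>0; v \<in> V - V\<^sub>0; u \<noteq> v\<rbrakk> \<Longrightarrow> f u v \<le> 0"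
proof
  let ?C = "{u. \<exists>v. edge_centre u v}"
  show "?C \<subseteq> V" by (auto simp: edge_centre_def)
  fix u u' :: 'a
  assume ne: "u \<noteq> u'"
  show "f u u' \<le> 0" if "u \<in> V - ?C" "u' \<in> V - ?C"
  proof (rule ccontr)
    assume "\<not> f u u' \<le> 0"
    moreover have "f u u' \<le> 1" using that ne pair_le by auto
    ultimately have "f u u' = 1" by linarith
    then show False using edge_has_centre[of u u'] that ne by auto
  qed
  assume "u \<in> ?C" "u' \<in> ?C"
  then obtain v v' where c: "edge_centre u v" "edge_centre u' v'" by blast
  then have V: "u \<in> V" "v \<in> V" "u' \<in> V" "v' \<in> V" "u \<noteq> v" "u' \<noteq> v'"
    and f1: "f u v = 1" "f u' v' = 1"
    unfolding edge_centre_def by auto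
  have "f u u' \<noteq> 1"
  proof
    assume "f u u' = 1"
    then have "edge_centre u u' \<or> edge_centre u' u"
      using edge_has_centre V ne by auto
    then show False using c centre_not_leaf by blast
  qed
  moreover have "f u u' \<noteq> 0"
  proof
    assume f0: "f u u' = 0"
    have "v \<noteq> v'"
      using second_neighbour_negative[OF c(1), of u'] f0 f1 V ne sym[of v' u'] by auto
    moreover have "v \<noteq> u'" "v' \<noteq> u" using f0 f1 sym[of u u'] by auto
    ultimately have S: "{u, v, u', v'} \<subseteq> V" "distinct [u, v, u', v']"
      using V ne by auto
    obtain z where z: "z \<in> V" "z \<notin> {u, v, u', v'}"
      and ge: "f u z + f v z + f u' z + f v' z \<ge> 2"
      using quad_gets[OF S] by blast
    \<comment> \<open>Each of the edges \<open>u v\<close> and \<open>u' v'\<close> gets at most 1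
      from \<open>z\<close>, hence exactly 1. A leaf getting 1 would push its centre to -1, so the
      centres get the units and \<open>z\<close> is a common leaf of \<open>u\<close> and
      \<open>u'\<close>.\<close>
    have "f u v + f u z + f v z \<le> 2" "f u' v' + f u' z + f v' z \<le> 2"
      using S z by (intro triple_le; auto)+
    moreover have "f u z \<le> 1" "f v z \<le> 1" "f u' z \<le> 1" "f v' z \<le> 1"
      using S z pair_le by auto
    moreover have "f v z = 1 \<Longrightarrow> f u z \<le> -1" "f v' z = 1 \<Longrightarrow> f u' z \<le> -1"
      using second_neighbour_negative[OF c(1)] second_neighbour_negative[OF c(2)] z by auto
    ultimately have fz: "f u z = 1" "f v z = 0" "f u' z = 1"
      using ge f1 by linarith+
    have "edge_centre u z"
      unfolding edge_centre_def using S z fz f1 sym[of z v] by auto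
    then have "f u u' \<le> -1"
      using second_neighbour_negative[of u z u'] S z fz ne sym[of z u'] by auto
    then show False using f0 by simp
  qed
  moreover have "f u u' \<le> 1" using V ne pair_le by auto
  ultimately show "f u u' \<le> -1" by linarith
qed

end


section \<open>Removing light sets\<close>

text \<open>
  Up to a constant, the pairs meeting a removable set of size \<open>s\<close> contribute at most the factor
  \<open>(1 + 1/a)^(n * (s div 4))\<close> to the normalised product. Adding \<open>s\<close> vertices to an extremal graph
  contributes at least about \<open>(1 + 1/a)^(n * 4s/15)\<close>, which is more for every \<open>s\<close> between 2 and 6.
\<close>

definition removable :: "('a set \<Rightarrow> int) \<Rightarrow> 'a set \<Rightarrow> 'a set \<Rightarrow> bool" where
  "removable x V S \<longleftrightarrow> S \<subseteq> V \<and> 2 \<le> card S \<and> card S \<le> 6 \<and>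
    pair_sum x V - pair_sum x (V - S) \<le> 10 + int (card S div 4 * card V)"

text \<open>If \<open>S\<close> weighs \<open>j\<close> more than \<open>t\<close>, every outside
  vertex must give \<open>j\<close> less. As there is at least one outside vertex, the excess is
  paid back.\<close>

lemma removableI:
  assumes "finite V" "S \<subseteq> V" "2 \<le> card S" "card S \<le> 6" "card S < card V"
    and "t \<le> 10" "0 \<le> j" "pair_sum x S = t + j"
    and "\<And>z. z \<in> V - S \<Longrightarrow> (\<Sum>y\<in>S. x {z, y}) \<le> int (card S div 4) - j"
  shows "removable x V S"
proof -
  define d where "d = int (card S div 4)"
  define m where "m = int (card (V - S))"
  have fS: "finite S" using assms finite_subset by blast
  have m: "1 \<le> m" "m \<le> int (card V)"
    using assms fS by (auto simp: m_def card_Diff_subset card_mono)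
  have "pair_sum x ((V - S) \<union> S) \<le> pair_sum x (V - S) + pair_sum x S + (d - j) * m"
    unfolding m_def by (rule pair_sum_union_le) (use assms fS in \<open>auto simp: d_def\<close>)
  moreover have "(V - S) \<union> S = V" using assms by auto
  moreover have "j \<le> j * m" "d * m \<le> d * int (card V)"
    using m assms(7) by (auto simp: mult_le_cancel_left1 d_def intro!: mult_left_mono)
  ultimately have "pair_sum x V - pair_sum x (V - S) \<le> 10 + d * int (card V)"
    using assms(6,8) by (simp add: left_diff_distrib)
  then show ?thesis
    using assms by (simp add: removable_def d_def)
qed

text \<open>If a set of size \<open>s\<close> weighs \<open>t + j\<close> with
  \<open>j >= 0\<close>, the bound for size \<open>s + 1\<close> leaves at most
  \<open>s div 4 - j\<close> from each outside vertex, so \<open>removableI\<close> applies.\<close>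

lemma pair_sum_le_step:
  assumes "finite V" "7 \<le> card V" "\<And>S. \<not> removable x V S" "2 \<le> s" "s \<le> 6" "t \<le> 10"
    and le: "\<And>X. X \<subseteq> V \<Longrightarrow> card X = Suc s \<Longrightarrow> pair_sum x X \<le> t + int (s div 4)"
    and X: "X \<subseteq> V" "card X = s"
  shows "pair_sum x X < t"
proof (rule ccontr)
  assume ge: "\<not> pair_sum x X < t"
  have fX: "finite X" using assms X finite_subset by blast
  have "removable x V X"
  proof (rule removableI[where t = t and j = "pair_sum x X - t"])
    fix z assume z: "z \<in> V - X"
    have "pair_sum x (insert z X) \<le> t + int (s div 4)"
      using z X fX by (intro le) auto
    then show "(\<Sum>y\<in>X. x {z, y}) \<le> int (card X div 4) - (pair_sum x X - t)"
      using z X fX by (simp add: pair_sum_insert)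
  qed (use assms X ge in auto)
  then show False using assms by blast
qed

lemma tight_if_no_removable:
  assumes V: "finite V" "7 \<le> card V" and nr: "\<And>S. \<not> removable x V S"
    and le7: "\<And>X. X \<subseteq> V \<Longrightarrow> card X = 7 \<Longrightarrow> pair_sum x X \<le> 9"
  shows "tight_weighting V (\<lambda>u v. x {u, v})"
proof -
  note step = pair_sum_le_step[OF V nr]
  \<comment> \<open>Each threshold \<open>t\<close> is the bound for the next larger size minus
    \<open>s div 4\<close>; strictness takes off one more.\<close>
  have le6: "pair_sum x X \<le> 7" if "X \<subseteq> V" "card X = 6" for X
    using step[of 6 8 X] le7 that by simp
  have le5: "pair_sum x X \<le> 5" if "X \<subseteq> V" "card X = 5" for X
    using step[of 5 6 X] le6 that by simp
  have le4: "pair_sum x X \<le> 3" if "X \<subseteq> V" "card X = 4" for X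
    using step[of 4 4 X] le5 that by simp
  have le3: "pair_sum x X \<le> 2" if "X \<subseteq> V" "card X = 3" for X
    using step[of 3 3 X] le4 that by simp
  have le2: "pair_sum x X \<le> 1" if "X \<subseteq> V" "card X = 2" for X
    using step[of 2 2 X] le3 that by simp
  \<comment> \<open>Unremovability with \<open>j = 0\<close>; sizes 2, 4 and 5 give the three
    existence conditions of the locale.\<close>
  have gets: "\<exists>z\<in>V - S. (\<Sum>y\<in>S. x {y, z}) > int (card S div 4)"
    if "S \<subseteq> V" "2 \<le> card S" "card S \<le> 6" "pair_sum x S \<le> 10" for S
  proof (rule ccontr)
    assume "\<not> ?thesis"
    then have "removable x V S"
      using V that
      by (intro removableI[where t = "pair_sum x S" and j = 0])
        (auto simp: not_less insert_commute)
    then show False using nr by blast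
  qed
  show ?thesis
  proof
    fix u v w y t
    show "x {u, v} = x {v, u}" by (simp add: insert_commute)
    show "x {u, v} \<le> 1" if "{u, v} \<subseteq> V" "distinct [u, v]"
      using le2[of "{u, v}"] that by (simp add: pair_sum_insert)
    show "x {u, v} + x {u, w} + x {v, w} \<le> 2" if "{u, v, w} \<subseteq> V" "distinct [u, v, w]"
      using le3[of "{u, v, w}"] that by (simp add: pair_sum_insert)
    show "x {u, v} + x {u, w} + x {u, y} + x {v, w} + x {v, y} + x {w, y} \<le> 3"
      if "{u, v, w, y} \<subseteq> V" "distinct [u, v, w, y]"
      using le4[of "{u, v, w, y}"] that by (simp add: pair_sum_insert)
    show "\<exists>z\<in>V. z \<notin> {u, v} \<and> 1 \<le> x {u, z} + x {v, z}"
      if S: "{u, v} \<subseteq> V" "distinct [u, v]"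
    proof -
      have c: "card {u, v} = 2" using S by simp
      have "pair_sum x {u, v} \<le> 10" using le2[OF S(1) c] by simp
      then obtain z where "z \<in> V - {u, v}" "(\<Sum>i\<in>{u, v}. x {i, z}) > 0"
        using gets[OF S(1)] unfolding c by auto
      then show ?thesis using S(2) by (intro bexI[of _ z]) auto
    qed
    show "\<exists>z\<in>V. z \<notin> {u, v, w, y} \<and> 2 \<le> x {u, z} + x {v, z} + x {w, z} + x {y, z}"
      if S: "{u, v, w, y} \<subseteq> V" "distinct [u, v, w, y]"
    proof -
      have c: "card {u, v, w, y} = 4" using S by simp
      have "pair_sum x {u, v, w, y} \<le> 10" using le4[OF S(1) c] by simp
      then obtain z where "z \<in> V - {u, v, w, y}" "(\<Sum>i\<in>{u, v, w, y}. x {i, z}) > 1"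
        using gets[OF S(1)] unfolding c by auto
      then show ?thesis using S(2) by (intro bexI[of _ z]) auto
    qed
    show "\<exists>z\<in>V. z \<notin> {u, v, w, y, t} \<and> 2 \<le> x {u, z} + x {v, z} + x {w, z} + x {y, z} + x {t, z}"
      if S: "{u, v, w, y, t} \<subseteq> V" "distinct [u, v, w, y, t]"
    proof -
      have c: "card {u, v, w, y, t} = 5" using S by simp
      have "pair_sum x {u, v, w, y, t} \<le> 10" using le5[OF S(1) c] by simp
      then obtain z where "z \<in> V - {u, v, w, y, t}" "(\<Sum>i\<in>{u, v, w, y, t}. x {i, z}) > 1"
        using gets[OF S(1)] unfolding c by auto
      then show ?thesis using S(2) by (intro bexI[of _ z]) auto
    qed
  qed
qed

section \<open>Normalised products\<close>

definition surplus :: "nat \<Rightarrow> ('a set \<Rightarrow> nat) \<Rightarrow> 'a set \<Rightarrow> int" where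
  "surplus a w e = int (w e) - int a"

definition norm_prod :: "nat \<Rightarrow> ('a set \<Rightarrow> nat) \<Rightarrow> 'a set \<Rightarrow> real" where
  "norm_prod a w V = (\<Prod>e\<in>nsets V 2. real (w e) / real a)"

text \<open>The normalised product of the Turan weighting whose part \<open>V\<^sub>0\<close> has
  \<open>k\<close> of the \<open>n\<close> vertices; pairs inside the other part contribute
  1.\<close>

definition turan_ratio :: "nat \<Rightarrow> nat \<Rightarrow> nat \<Rightarrow> real" where
  "turan_ratio a n k = (1 - 1 / real a) ^ (k choose 2) * (1 + 1 / real a) ^ (k * (n - k))"

text \<open>Bernoulli on both sides of \<open>a\<close>. Below \<open>a\<close> it gives a power of
  \<open>1 - 1/a\<close>, and \<open>1 - 1/a\<close> is at most the inverse of
  \<open>1 + 1/a\<close>. Exponents can be negative, hence \<open>powr\<close>.\<close>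

lemma ratio_le_powr:
  assumes "a \<ge> 1"
  shows "real m / real a \<le> (1 + 1 / real a) powr (real_of_int (int m - int a))"
proof (cases "a \<le> m")
  case True
  define y where "y = m - a"
  have "real m / real a = 1 + real y * (1 / real a)"
    using True assms by (simp add: y_def field_simps)
  also have "\<dots> \<le> (1 + 1 / real a) ^ y"
    by (rule Bernoulli_inequality) (use divide_nonneg_nonneg[of 1 "real a"] in linarith)
  also have "\<dots> = (1 + 1 / real a) powr (real y)"
    using assms by (simp add: powr_realpow add_pos_nonneg)
  finally show ?thesis using True by (simp add: y_def)
next
  case False
  define y where "y = a - m"
  have pos: "1 + 1 / real a > 0" by (simp add: add_pos_nonneg)
  have "real m / real a = 1 + real y * (- (1 / real a))"
    using False assms by (simp add: y_def field_simps)
  also have "\<dots> \<le> (1 + - (1 / real a)) ^ y"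
    by (rule Bernoulli_inequality) (use assms in auto)
  also have "\<dots> \<le> (1 / (1 + 1 / real a)) ^ y"
  proof (rule power_mono)
    show "0 \<le> 1 + - (1 / real a)" using assms by auto
    have "(1 + - (1 / real a)) * (1 + 1 / real a) \<le> 1"
      by (simp add: algebra_simps)
    then show "1 + - (1 / real a) \<le> 1 / (1 + 1 / real a)"
      using pos by (simp add: pos_le_divide_eq)
  qed
  also have "\<dots> = (1 + 1 / real a) powr (- real y)"
    using pos by (simp add: powr_minus powr_realpow power_one_over inverse_eq_divide)
  finally show ?thesis using False by (simp add: y_def of_nat_diff)
qed

lemma prod_ratio_le_powr:
  assumes "a \<ge> 1" "finite E"
  shows "(\<Prod>e\<in>E. real (w e) / real a)
    \<le> (1 + 1 / real a) powr (real_of_int (\<Sum>e\<in>E. surplus a w e))"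
proof -
  have pos: "1 + 1 / real a > 0" by (simp add: add_pos_nonneg)
  have "(\<Prod>e\<in>E. real (w e) / real a)
      \<le> (\<Prod>e\<in>E. (1 + 1 / real a) powr (real_of_int (surplus a w e)))"
    using ratio_le_powr[OF assms(1)] by (intro prod_mono) (auto simp: surplus_def)
  also have "\<dots> = (1 + 1 / real a) powr (real_of_int (\<Sum>e\<in>E. surplus a w e))"
    using pos by (simp add: powr_sum)
  finally show ?thesis .
qed

lemma norm_prod_nonneg: "norm_prod a w V \<ge> 0"
  unfolding norm_prod_def by (intro prod_nonneg) auto

lemma norm_prod_remove:
  assumes "a \<ge> 1" "finite V" "S \<subseteq> V"
    and "pair_sum (surplus a w) V - pair_sum (surplus a w) (V - S) \<le> int p"
  shows "norm_prod a w V \<le> norm_prod a w (V - S) * (1 + 1 / real a) ^ p"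
proof -
  let ?E = "nsets V 2 - nsets (V - S) 2"
  have pos: "1 + 1 / real a > 0" by (simp add: add_pos_nonneg)
  have sub: "nsets (V - S) 2 \<subseteq> nsets V 2" by (rule nsets_mono) auto
  have fin: "finite (nsets V 2)" using assms finite_imp_finite_nsets by blast
  have "(\<Prod>e\<in>?E. real (w e) / real a)
      \<le> (1 + 1 / real a) powr (real_of_int (\<Sum>e\<in>?E. surplus a w e))"
    using assms fin by (intro prod_ratio_le_powr) auto
  also have "(\<Sum>e\<in>?E. surplus a w e)
      = pair_sum (surplus a w) V - pair_sum (surplus a w) (V - S)"
    unfolding pair_sum_def using sum_diff[OF fin sub] by auto
  also have "(1 + 1 / real a) powr (real_of_int \<dots>) \<le> (1 + 1 / real a) powr (real p)"
    using assms(4) by (intro powr_mono) auto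
  finally have "(\<Prod>e\<in>?E. real (w e) / real a) \<le> (1 + 1 / real a) ^ p"
    using pos by (simp add: powr_realpow)
  moreover have "norm_prod a w V = norm_prod a w (V - S) * (\<Prod>e\<in>?E. real (w e) / real a)"
    unfolding norm_prod_def using prod.subset_diff[OF sub fin] by (simp add: mult.commute)
  ultimately show ?thesis
    using norm_prod_nonneg[of a w "V - S"] by (simp add: mult_left_mono)
qed

lemma norm_prod_le_power:
  assumes "a \<ge> 1" "finite V" "7 \<le> card V"
    and "\<And>X. X \<subseteq> V \<Longrightarrow> card X = 7 \<Longrightarrow> pair_sum (surplus a w) X \<le> 9"
  shows "norm_prod a w V \<le> (1 + 1 / real a) ^ (card V ^ 2)"
proof -
  define n where "n = int (card V)"
  have "14 * pair_sum (surplus a w) V \<le> 3 * n * (n - 1)"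
    unfolding n_def by (rule pair_sum_le_average) (use assms in auto)
  also have "\<dots> \<le> 14 * n ^ 2"
    by (simp add: n_def power2_eq_square algebra_simps)
  finally have "pair_sum (surplus a w) V \<le> int (card V ^ 2)"
    by (simp add: n_def)
  \<comment> \<open>Removing all of \<open>V\<close> leaves the empty product 1.\<close>
  then show ?thesis
    using norm_prod_remove[of a V V w "card V ^ 2"] assms
    by (simp add: norm_prod_def pair_sum_def[of _ "{}"] nsets_def conj_commute cong: conj_cong)
qed

lemma norm_prod_le_turan_ratio:
  assumes a: "a \<ge> 1" and V: "finite V" "V\<^sub>0 \<subseteq> V"
    and pair: "\<And>u v. \<lbrakk>u \<in> V; v \<in> V; u \<noteq> v\<rbrakk> \<Longrightarrow> surplus a w {u, v} \<le> 1"
    and inner0: "\<And>u v. \<lbrakk>u \<in> V\<^sub>0; v \<in> V\<^sub>0; u \<noteq> v\<rbrakk> \<Longrightarrow> surplus a w {u, v} \<le> -1"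
    and inner1: "\<And>u v. \<lbrakk>u \<in> V - V\<^sub>0; v \<in> V - V\<^sub>0; u \<noteq> v\<rbrakk> \<Longrightarrow> surplus a w {u, v} \<le> 0"
  shows "norm_prod a w V \<le> turan_ratio a (card V) (card V\<^sub>0)"
proof -
  let ?g = "\<lambda>e. real (w e) / real a"
  let ?W = "V - V\<^sub>0"
  have fin: "finite V\<^sub>0" "finite ?W" using V finite_subset by auto
  have ratio: "?g e \<le> 1 + real_of_int c / real a" if "surplus a w e \<le> c" for e c
  proof -
    have "real (w e) \<le> real a + real_of_int c"
      using that unfolding surplus_def by linarith
    then show ?thesis using a by (simp add: field_simps)
  qed
  have "norm_prod a w V = (\<Prod>e\<in>nsets V\<^sub>0 2. ?g e) * (\<Prod>e\<in>nsets ?W 2. ?g e) *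
      (\<Prod>(u, v)\<in>V\<^sub>0 \<times> ?W. ?g {u, v})"
    using prod.nsets_two_partition[OF fin, of ?g] V
    by (simp add: norm_prod_def Un_absorb1)
  also have "\<dots> \<le> (1 - 1 / real a) ^ (card V\<^sub>0 choose 2) * 1 *
      (1 + 1 / real a) ^ (card V\<^sub>0 * (card V - card V\<^sub>0))"
  proof (intro mult_mono)
    have "?g e \<le> 1 - 1 / real a" if "e \<in> nsets V\<^sub>0 2" for e
      using that ratio[of e "-1"] inner0 by (auto elim!: nsets2_E)
    then have "(\<Prod>e\<in>nsets V\<^sub>0 2. ?g e) \<le> (\<Prod>e\<in>nsets V\<^sub>0 2. 1 - 1 / real a)"
      by (intro prod_mono) auto
    then show "(\<Prod>e\<in>nsets V\<^sub>0 2. ?g e) \<le> (1 - 1 / real a) ^ (card V\<^sub>0 choose 2)"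
      using card_nsets_two[OF fin(1)] by simp
    have "?g e \<le> 1" if "e \<in> nsets ?W 2" for e
      using that ratio[of e 0] inner1 by (auto elim!: nsets2_E)
    then show "(\<Prod>e\<in>nsets ?W 2. ?g e) \<le> 1"
      by (intro prod_le_1) auto
    have "?g {u, v} \<le> 1 + 1 / real a" if "u \<in> V\<^sub>0" "v \<in> ?W" for u v
      using that ratio[of "{u, v}" 1] pair[of u v] V by auto
    then have "(\<Prod>(u, v)\<in>V\<^sub>0 \<times> ?W. ?g {u, v}) \<le> (\<Prod>(u, v)\<in>V\<^sub>0 \<times> ?W. 1 + 1 / real a)"
      by (intro prod_mono) auto
    then show "(\<Prod>(u, v)\<in>V\<^sub>0 \<times> ?W. ?g {u, v})
        \<le> (1 + 1 / real a) ^ (card V\<^sub>0 * (card V - card V\<^sub>0))"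
      using V fin by (simp add: card_cartesian_product card_Diff_subset case_prod_unfold)
  qed (use a in \<open>auto intro!: prod_nonneg mult_nonneg_nonneg\<close>)
  finally show ?thesis by (simp add: turan_ratio_def)
qed

section \<open>Growth of the extremal product\<close>

text \<open>Seven growing factors outweigh four shrinking ones. The margin is small at
  \<open>y = 1/2\<close>, the case \<open>a = 2\<close>, where the product is 2187/2048.\<close>

lemma shrink_growth_balance:
  fixes y :: real
  assumes "0 \<le> y" "y \<le> 1 / 2"
  shows "(1 - y) ^ 4 * (1 + y) ^ 7 \<ge> 1"
proof -
  have y: "y ^ 2 \<le> 1 / 4" "y ^ 3 \<le> 1 / 8" "y ^ 4 \<le> 1 / 16"
    using power_mono[OF assms(2,1), of 2] power_mono[OF assms(2,1), of 3]
      power_mono[OF assms(2,1), of 4] by (simp_all add: power_divide)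
  \<comment> \<open>Subtract 1 from the product and divide by \<open>y\<close>. Then
    \<open>(1/2 - y) * p + 1/8\<close> matches the coefficients up to degree 4, and \<open>q\<close>
    collects what remains in degrees 5 to 8.\<close>
  define p where "p = 23 / 4 + 19 / 2 * y - 3 * y ^ 2 - 18 * y ^ 3 - 8 * y ^ 4"
  define q where "q = 6 - 6 * y - 11 * y ^ 2 - y ^ 3"
  have "p \<ge> 0" "q \<ge> 0" using y assms by (simp_all add: p_def q_def)
  then have "0 \<le> y * ((1 / 2 - y) * p + 1 / 8 + y ^ 5 * q + 3 * y ^ 9 + y ^ 10)"
    using assms by (intro mult_nonneg_nonneg add_nonneg_nonneg) auto
  also have "\<dots> = (1 - y) ^ 4 * (1 + y) ^ 7 - 1"
    unfolding p_def q_def by algebra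
  finally show ?thesis by simp
qed

lemma turan_ratio_pos: "a \<ge> 2 \<Longrightarrow> turan_ratio a n k > 0"
  unfolding turan_ratio_def by (intro mult_pos_pos zero_less_power) (auto simp: add_pos_nonneg)

text \<open>Moving one more vertex into \<open>V\<^sub>0\<close> multiplies the ratio by
  \<open>(1 - 1/a)^k * (1 + 1/a)^(m - 2k - 1)\<close>. By \<open>shrink_growth_balance\<close> this
  exceeds 1 once \<open>4 (m - 2k - 1) > 7k\<close>, that is \<open>4m > 15k + 4\<close>, which is
  impossible at an optimal \<open>k\<close>.\<close>

lemma turan_ratio_optimum:
  assumes "a \<ge> 2"
  obtains k where "k \<le> m" "\<And>k'. k' \<le> m \<Longrightarrow> turan_ratio a m k' \<le> turan_ratio a m k"
    "4 * m \<le> 15 * k + 4"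
proof -
  define c where "c = 1 - 1 / real a"
  define r where "r = 1 + 1 / real a"
  have c0: "c > 0" and r1: "r > 1" using assms by (auto simp: c_def r_def)
  have cr: "c ^ 4 * r ^ 7 \<ge> 1"
    unfolding c_def r_def by (rule shrink_growth_balance) (use assms in auto)
  let ?t = "turan_ratio a m"
  have "Max (?t ` {..m}) \<in> ?t ` {..m}" by (intro Max_in) auto
  then obtain k where k: "k \<le> m" "?t k = Max (?t ` {..m})"
    by (metis atMost_iff imageE)
  have max: "?t k' \<le> ?t k" if "k' \<le> m" for k'
    unfolding k(2) using that by (intro Max_ge) auto
  have "4 * m \<le> 15 * k + 4"
  proof (rule ccontr)
    assume "\<not> ?thesis"
    then have lt: "15 * k + 4 < 4 * m" by simp
    then have "2 * k + 1 \<le> m" by simp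
    then obtain q where q: "m = 2 * k + 1 + q" using le_Suc_ex by blast
    have q7: "4 * q > 7 * k" using lt q by simp
    have "?t (k + 1) = ?t k * (c ^ k * r ^ q)"
    proof -
      have "(k + 1) choose 2 = (k choose 2) + k"
        by (simp add: numeral_2_eq_2)
      moreover have "(k + 1) * (m - (k + 1)) = k * (m - k) + q"
        using q by (simp add: algebra_simps)
      ultimately show ?thesis
        by (simp only: turan_ratio_def c_def r_def power_add mult_ac)
    qed
    moreover have "?t (k + 1) \<le> ?t k" using max lt by simp
    moreover have "?t k > 0" using turan_ratio_pos assms by blast
    ultimately have "c ^ k * r ^ q \<le> 1" by (simp add: mult_le_cancel_left1)
    then have "(c ^ k * r ^ q) ^ 4 \<le> 1"
      using c0 r1 by (intro power_le_one) auto
    moreover have "(c ^ k * r ^ q) ^ 4 = c ^ (4 * k) * r ^ (4 * q)"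
      by (simp add: power_mult_distrib power_mult[symmetric] mult.commute)
    moreover have "c ^ (4 * k) * r ^ (4 * q) > c ^ (4 * k) * r ^ (7 * k)"
      using q7 c0 r1 by (intro mult_strict_left_mono power_strict_increasing) auto
    moreover have "c ^ (4 * k) * r ^ (7 * k) = (c ^ 4 * r ^ 7) ^ k"
      by (simp add: power_mult_distrib power_mult)
    moreover have "(c ^ 4 * r ^ 7) ^ k \<ge> 1" using cr by (rule one_le_power)
    ultimately show False by linarith
  qed
  then show thesis using that k max by blast
qed

text \<open>All \<open>s\<close> new vertices join the part outside \<open>V\<^sub>0\<close> of an
  optimal configuration on \<open>m\<close> vertices and see \<open>k\<close> vertices of
  \<open>V\<^sub>0\<close> each, which gains \<open>s * k\<close> factors. Here \<open>g\<close> is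
  the profit beyond the cost of a removal.\<close>

lemma turan_ratio_gain:
  assumes a: "a \<ge> 2" and s: "2 \<le> s" "s \<le> 6" and n: "n = m + s" "n \<ge> 15 * g + 230" and "k' \<le> m"
  obtains k where "k \<le> n"
    "turan_ratio a m k' * (1 + 1 / real a) ^ (10 + s div 4 * n + g) \<le> turan_ratio a n k"
proof -
  obtain k where k: "k \<le> m" "\<And>k'. k' \<le> m \<Longrightarrow> turan_ratio a m k' \<le> turan_ratio a m k"
    "4 * m \<le> 15 * k + 4"
    using turan_ratio_optimum[OF a] by blast
  have "s \<in> {2, 3, 4, 5, 6}" using s by auto
  \<comment> \<open>The case \<open>s = 4\<close> fixes the threshold: the lower bound
    \<open>16 (n - 5) / 15\<close> on \<open>4k\<close> reaches \<open>10 + n + g\<close> precisely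
    when \<open>n >= 15g + 230\<close>.\<close>
  then have le: "10 + s div 4 * n + g \<le> s * k" using n k(3) by auto
  have "turan_ratio a m k' * (1 + 1 / real a) ^ (10 + s div 4 * n + g)
      \<le> turan_ratio a m k * (1 + 1 / real a) ^ (s * k)"
    using k(2)[OF assms(6)] le turan_ratio_pos[OF a, of m k]
    by (intro mult_mono power_increasing) (auto simp: less_imp_le)
  also have "k * (n - k) = k * (m - k) + s * k"
    using n k(1) by (simp add: algebra_simps)
  then have "turan_ratio a m k * (1 + 1 / real a) ^ (s * k) = turan_ratio a n k"
    by (simp add: turan_ratio_def power_add)
  finally show thesis using that[of k] k(1) n(1) by simp
qed

section \<open>Upper bound\<close>

lemma turan_or_remove:
  assumes a: "a \<ge> 1" and V: "finite V" "7 \<le> card V"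
    and le7: "\<And>X. X \<subseteq> V \<Longrightarrow> card X = 7 \<Longrightarrow> pair_sum (surplus a w) X \<le> 9"
  obtains k where "k \<le> card V" "norm_prod a w V \<le> turan_ratio a (card V) k"
  | S where "S \<subseteq> V" "2 \<le> card S" "card S \<le> 6"
    "norm_prod a w V \<le> norm_prod a w (V - S) * (1 + 1 / real a) ^ (10 + card S div 4 * card V)"
proof (cases "\<exists>S. removable (surplus a w) V S")
  case True
  then obtain S where S: "removable (surplus a w) V S" by blast
  then have "norm_prod a w V
      \<le> norm_prod a w (V - S) * (1 + 1 / real a) ^ (10 + card S div 4 * card V)"
    using a V by (intro norm_prod_remove) (auto simp: removable_def)
  then show thesis using that(2) S by (auto simp: removable_def)
next
  case False
  interpret tight_weighting V "\<lambda>u v. surplus a w {u, v}"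
    using False V le7 by (intro tight_if_no_removable) auto
  obtain V\<^sub>0 where "V\<^sub>0 \<subseteq> V"
    "\<And>u v. \<lbrakk>u \<in> V\<^sub>0; v \<in> V\<^sub>0; u \<noteq> v\<rbrakk> \<Longrightarrow> surplus a w {u, v} \<le> -1"
    "\<And>u v. \<lbrakk>u \<in> V - V\<^sub>0; v \<in> V - V\<^sub>0; u \<noteq> v\<rbrakk> \<Longrightarrow> surplus a w {u, v} \<le> 0"
    using turan_pattern by blast
  then have "norm_prod a w V \<le> turan_ratio a (card V) (card V\<^sub>0)" "card V\<^sub>0 \<le> card V"
    using a V pair_le by (auto intro!: norm_prod_le_turan_ratio card_mono)
  then show thesis using that(1) by blast
qed

text \<open>\<open>L\<close> is the error exponent on smaller sets, and a removal improves it by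
  \<open>g\<close>; the Turan alternative has no error. With \<open>g = 0\<close> the error stays
  bounded through an induction, with \<open>g = L\<close> it vanishes.\<close>

lemma turan_or_gain:
  assumes a: "a \<ge> 2" and V: "finite V" "card V \<ge> 15 * g + 230"
    and le7: "\<And>X. X \<subseteq> V \<Longrightarrow> card X = 7 \<Longrightarrow> pair_sum (surplus a w) X \<le> 9"
    and IH: "\<And>W. \<lbrakk>W \<subset> V; 7 \<le> card W\<rbrakk> \<Longrightarrow>
      \<exists>k\<le>card W. norm_prod a w W \<le> turan_ratio a (card W) k * (1 + 1 / real a) ^ L"
  shows "\<exists>k\<le>card V. norm_prod a w V \<le> turan_ratio a (card V) k * (1 + 1 / real a) ^ (L - g)"
proof -
  let ?r = "1 + 1 / real a"
  have r1: "?r \<ge> 1" by simp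
  from a have a1: "a \<ge> 1" by simp
  have V7: "7 \<le> card V" using V by simp
  show ?thesis
  proof (rule turan_or_remove[OF a1 V(1) V7 le7])
    fix k assume k: "k \<le> card V" "norm_prod a w V \<le> turan_ratio a (card V) k"
    have "turan_ratio a (card V) k \<le> turan_ratio a (card V) k * ?r ^ (L - g)"
      using turan_ratio_pos[OF a, of "card V" k] one_le_power[OF r1, of "L - g"]
      by (simp add: mult_le_cancel_left1)
    then show ?thesis using k by (intro exI[of _ k]) auto
  next
    fix S assume S: "S \<subseteq> V" "2 \<le> card S" "card S \<le> 6"
      and le: "norm_prod a w V \<le> norm_prod a w (V - S) * ?r ^ (10 + card S div 4 * card V)"
    have fS: "finite S" using S V finite_subset by blast
    have card: "card V = card (V - S) + card S"
      using S fS V card_mono[OF V(1) S(1)] by (simp add: card_Diff_subset)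
    have "S \<noteq> {}" using S by auto
    then have "V - S \<subset> V" using S by blast
    moreover have "7 \<le> card (V - S)" using card S V by simp
    ultimately obtain k' where k': "k' \<le> card (V - S)"
      "norm_prod a w (V - S) \<le> turan_ratio a (card (V - S)) k' * ?r ^ L"
      using IH by blast
    obtain k where k: "k \<le> card V" "turan_ratio a (card (V - S)) k' *
        ?r ^ (10 + card S div 4 * card V + g) \<le> turan_ratio a (card V) k"
      using turan_ratio_gain[OF a S(2,3) card V(2) k'(1)] by blast
    have "norm_prod a w V
        \<le> turan_ratio a (card (V - S)) k' * ?r ^ L * ?r ^ (10 + card S div 4 * card V)"
      using le mult_right_mono[OF k'(2), of "?r ^ (10 + card S div 4 * card V)"] by simp
    also have "\<dots> \<le> turan_ratio a (card (V - S)) k' *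
        ?r ^ (10 + card S div 4 * card V + g) * ?r ^ (L - g)"
    proof -
      \<comment> \<open>Truncated subtraction is harmless, as \<open>L <= g + (L - g)\<close> always
        holds.\<close>
      have "?r ^ (L + (10 + card S div 4 * card V))
          \<le> ?r ^ (10 + card S div 4 * card V + g + (L - g))"
        by (rule power_increasing) auto
      then show ?thesis
        using turan_ratio_pos[OF a, of "card (V - S)" k']
        by (simp add: power_add mult.assoc)
    qed
    also have "\<dots> \<le> turan_ratio a (card V) k * ?r ^ (L - g)"
      using k(2) by (intro mult_right_mono) auto
    finally show ?thesis using k(1) by blast
  qed
qed

text \<open>Induction with \<open>g = 0\<close>, so the error never grows. Below 230 vertices the
  crude bound of \<open>norm_prod_le_power\<close> has exponent at most \<open>230 ^ 2\<close>, and
  \<open>k = 0\<close> has ratio 1.\<close>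

lemma norm_prod_le_turan_up_to_const:
  assumes a: "a \<ge> 2" and V: "finite V" "7 \<le> card V"
    and le7: "\<And>X. X \<subseteq> V \<Longrightarrow> card X = 7 \<Longrightarrow> pair_sum (surplus a w) X \<le> 9"
  shows "\<exists>k\<le>card V. norm_prod a w V \<le> turan_ratio a (card V) k * (1 + 1 / real a) ^ (230 ^ 2)"
  using V le7
proof (induction "card V" arbitrary: V rule: less_induct)
  case less
  show ?case
  proof (cases "card V \<ge> 230")
    case True
    have "\<exists>k\<le>card V. norm_prod a w V
        \<le> turan_ratio a (card V) k * (1 + 1 / real a) ^ (230 ^ 2 - 0)"
    proof (rule turan_or_gain[OF a less.prems(1)])
      fix W assume W: "W \<subset> V" "7 \<le> card W"
      show "\<exists>k\<le>card W. norm_prod a w W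
          \<le> turan_ratio a (card W) k * (1 + 1 / real a) ^ (230 ^ 2)"
      proof (rule less.hyps)
        show "card W < card V" using W less.prems(1) psubset_card_mono by blast
        show "finite W" using W less.prems(1) finite_subset by blast
      qed (use W less.prems in auto)
    qed (use True less.prems in auto)
    then show ?thesis by simp
  next
    case False
    have "norm_prod a w V \<le> (1 + 1 / real a) ^ (card V ^ 2)"
      using a less.prems by (intro norm_prod_le_power) auto
    also have "\<dots> \<le> (1 + 1 / real a) ^ (230 ^ 2)"
      using False by (intro power_increasing power_mono) auto
    also have "\<dots> = turan_ratio a (card V) 0 * (1 + 1 / real a) ^ (230 ^ 2)"
      by (simp add: turan_ratio_def binomial_eq_0)
    finally show ?thesis by blast
  qed
qed

text \<open>One more application of \<open>turan_or_gain\<close>, with \<open>g\<close> equal to the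
  whole error exponent \<open>230 ^ 2\<close>, cancels the error; this sets the threshold
  \<open>15 * g + 230\<close>.\<close>

lemma norm_prod_le_turan:
  assumes a: "a \<ge> 2" and V: "finite V" "card V \<ge> 15 * 230 ^ 2 + 230"
    and le7: "\<And>X. X \<subseteq> V \<Longrightarrow> card X = 7 \<Longrightarrow> pair_sum (surplus a w) X \<le> 9"
  shows "\<exists>k\<le>card V. norm_prod a w V \<le> turan_ratio a (card V) k"
proof -
  have "\<exists>k\<le>card V. norm_prod a w V
      \<le> turan_ratio a (card V) k * (1 + 1 / real a) ^ (230 ^ 2 - 230 ^ 2)"
  proof (rule turan_or_gain[OF a V])
    fix W assume "W \<subset> V" "7 \<le> card W"
    then show "\<exists>k\<le>card W. norm_prod a w W
        \<le> turan_ratio a (card W) k * (1 + 1 / real a) ^ (230 ^ 2)"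
      using V(1) le7 finite_subset[of W V] by (intro norm_prod_le_turan_up_to_const[OF a]) auto
  qed (use le7 in auto)
  then show ?thesis by simp
qed

section \<open>The extremal family\<close>

definition turan_size_prod :: "nat \<Rightarrow> nat \<Rightarrow> nat \<Rightarrow> nat" where
  "turan_size_prod a n k = (a - 1) ^ (k choose 2) * a ^ ((n - k) choose 2) * (a + 1) ^ (k * (n - k))"

lemma choose_two_split:
  assumes "k \<le> n"
  shows "n choose 2 = (k choose 2) + ((n - k) choose 2) + k * (n - k)"
proof -
  have "card (nsets ({..<k} \<union> {k..<n}) 2)
      = card (nsets {..<k} 2) + card (nsets {k..<n} 2) + card ({..<k} \<times> {k..<n})"
    using sum.nsets_two_partition[of "{..<k}" "{k..<n}" "\<lambda>_. 1 :: nat"]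
    by (simp add: case_prod_unfold ivl_disj_int)
  moreover have "{..<k} \<union> {k..<n} = {..<n}" using assms by auto
  ultimately show ?thesis by (simp add: card_nsets_two card_cartesian_product)
qed

lemma turan_size_prod_eq:
  assumes "a \<ge> 1" "k \<le> n"
  shows "real (turan_size_prod a n k) = turan_ratio a n k * real a ^ (n choose 2)"
proof -
  have "real (a - 1) = (1 - 1 / real a) * real a" "real (a + 1) = (1 + 1 / real a) * real a"
    using assms by (simp_all add: field_simps)
  then show ?thesis
    unfolding choose_two_split[OF assms(2)] turan_size_prod_def turan_ratio_def
    by (simp add: power_mult_distrib power_add)
qed

text \<open>Two explicit parts with conditions on cross pairs are the form to which
  \<open>nsets_two_partition\<close> applies.\<close>

lemma turan_graphs_two_iff:
  "(V, w) \<in> turan_graphs 2 1 a n \<longleftrightarrow> multigraph (V, w) \<and> V = {1..n} \<and>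
    (\<exists>A B. A \<inter> B = {} \<and> A \<union> B = {1..n} \<and> (\<forall>e\<in>nsets A 2. w e = a - 1) \<and>
      (\<forall>e\<in>nsets B 2. w e = a) \<and> (\<forall>u\<in>A. \<forall>v\<in>B. w {u, v} = a + 1))"
  (is "_ \<longleftrightarrow> _ \<and> _ \<and> (\<exists>A B. ?P A B)")
proof -
  let ?Q = "\<lambda>F :: nat \<Rightarrow> nat set. disjoint_family_on F {..<2} \<and> (\<Union>i<2. F i) = {1..n} \<and>
        (\<forall>e\<in>nsets (F 0) 2. w e = a - 1) \<and>
        (\<forall>i\<in>{1..<2}. \<forall>e\<in>nsets (F i) 2. w e = a) \<and>
        (\<forall>e\<in>nsets {1..n} 2. (\<forall>i<2. \<not> e \<subseteq> F i) \<longrightarrow> w e = a + 1)"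
  have two: "{..<2::nat} = {0, 1}" "{1..<2::nat} = {1}" by auto
  have all2: "(\<forall>i<2::nat. R i) \<longleftrightarrow> R 0 \<and> R 1" for R
    by (auto simp: less_2_cases_iff)
  have cross: "(\<forall>e\<in>nsets {1..n} 2. \<not> e \<subseteq> A \<and> \<not> e \<subseteq> B \<longrightarrow> w e = a + 1)
      \<longleftrightarrow> (\<forall>u\<in>A. \<forall>v\<in>B. w {u, v} = a + 1)"
    if "A \<inter> B = {}" "A \<union> B = {1..n}" for A B
  proof -
    have eq: "nsets {1..n} 2 = nsets A 2 \<union> nsets B 2 \<union> (\<lambda>(u, v). {u, v}) ` (A \<times> B)"
      using nsets_two_partition[OF that(1)] that(2) by simp
    have sub: "e \<subseteq> A \<or> e \<subseteq> B" if "e \<in> nsets A 2 \<union> nsets B 2" for e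
      using that by (auto simp: nsets_def)
    show ?thesis
    proof (intro iffI ballI impI)
      fix u v
      assume H: "\<forall>e\<in>nsets {1..n} 2. \<not> e \<subseteq> A \<and> \<not> e \<subseteq> B \<longrightarrow> w e = a + 1"
        and uv: "u \<in> A" "v \<in> B"
      have "{u, v} \<in> nsets {1..n} 2" unfolding eq using uv by auto
      moreover have "\<not> {u, v} \<subseteq> A \<and> \<not> {u, v} \<subseteq> B" using uv that(1) by auto
      ultimately show "w {u, v} = a + 1" using H[rule_format] by simp
    next
      fix e
      assume H: "\<forall>u\<in>A. \<forall>v\<in>B. w {u, v} = a + 1"
        and e: "e \<in> nsets {1..n} 2" "\<not> e \<subseteq> A \<and> \<not> e \<subseteq> B"
      have "e \<notin> nsets A 2 \<union> nsets B 2" using sub[of e] e(2) by argo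
      then have "e \<in> (\<lambda>(u, v). {u, v}) ` (A \<times> B)"
        using e(1) unfolding eq by (simp only: Un_iff simp_thms)
      then obtain u v where "u \<in> A" "v \<in> B" "e = {u, v}" by auto
      then show "w e = a + 1" using H by simp
    qed
  qed
  have Q: "?Q F \<longleftrightarrow> ?P (F 0) (F 1)" for F
  proof -
    have "disjoint_family_on F {..<2} \<longleftrightarrow> F 0 \<inter> F 1 = {}"
      unfolding disjoint_family_on_def two(1) by (simp add: Int_commute)
    moreover have "(\<Union>i<2. F i) = F 0 \<union> F 1" unfolding two(1) by simp
    moreover have "(\<forall>i\<in>{1..<2}. \<forall>e\<in>nsets (F i) 2. w e = a) \<longleftrightarrow> (\<forall>e\<in>nsets (F 1) 2. w e = a)"
      unfolding two(2) by simp
    ultimately show ?thesis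
      unfolding all2 using cross[of "F 0" "F 1"]
      by (cases "F 0 \<inter> F 1 = {}"; cases "F 0 \<union> F 1 = {1..n}"; simp)
  qed
  have "(\<exists>F. ?Q F) \<longleftrightarrow> (\<exists>A B. ?P A B)"
  proof
    assume "\<exists>F. ?Q F"
    then obtain F where "?Q F" ..
    then have "?P (F 0) (F 1)" using Q[of F] by (rule rev_iffD1)
    then show "\<exists>A B. ?P A B" by (intro exI)
  next
    assume "\<exists>A B. ?P A B"
    then obtain A B where AB: "?P A B" by (elim exE)
    define F where "F = (\<lambda>i::nat. if i = 0 then A else B)"
    have F: "F 0 = A" "F 1 = B" by (simp_all add: F_def)
    have "?P (F 0) (F 1)" unfolding F by (rule AB)
    then have "?Q F" using Q[of F] by (rule rev_iffD2)
    then show "\<exists>F. ?Q F" by (rule exI[where x = F])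
  qed
  then show ?thesis unfolding turan_graphs_def by simp
qed

text \<open>The product depends only on the size of \<open>A\<close>, and every size from 0 to
  \<open>n\<close> occurs since parts may be empty. So the maximum over graphs becomes one over
  \<open>k\<close>.\<close>

lemma edge_prod_turan_graphs:
  "edge_prod ` turan_graphs 2 1 a n = turan_size_prod a n ` {..n}"
proof -
  have eq: "edge_prod (A \<union> B, w) = turan_size_prod a n (card A)"
    if "A \<inter> B = {}" "A \<union> B = {1..n}" "\<forall>e\<in>nsets A 2. w e = a - 1"
      "\<forall>e\<in>nsets B 2. w e = a" "\<forall>u\<in>A. \<forall>v\<in>B. w {u, v} = a + 1"
    for A B :: "nat set" and w
  proof -
    have fin: "finite A" "finite B" using that(2) by (metis finite_Un finite_atLeastAtMost)+
    have "card A + card B = n"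
      using card_Un_disjoint[OF fin that(1)] that(2) by simp
    then have B: "card B = n - card A" by simp
    have "edge_prod (A \<union> B, w)
        = (\<Prod>e\<in>nsets A 2. w e) * (\<Prod>e\<in>nsets B 2. w e) * (\<Prod>(u, v)\<in>A \<times> B. w {u, v})"
      using prod.nsets_two_partition[OF fin that(1), of w] by (simp add: edge_prod_def)
    also have "\<dots> = (\<Prod>e\<in>nsets A 2. a - 1) * (\<Prod>e\<in>nsets B 2. a) * (\<Prod>(u, v)\<in>A \<times> B. a + 1)"
      using that by (intro arg_cong2[where f = "(*)"] prod.cong) auto
    also have "\<dots> = turan_size_prod a n (card A)"
      using fin by (simp add: turan_size_prod_def card_nsets_two card_cartesian_product B
          case_prod_unfold)
    finally show ?thesis .
  qed
  show ?thesis
  proof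
    show "edge_prod ` turan_graphs 2 1 a n \<subseteq> turan_size_prod a n ` {..n}"
    proof
      fix p assume "p \<in> edge_prod ` turan_graphs 2 1 a n"
      then obtain V w where G: "(V, w) \<in> turan_graphs 2 1 a n" "p = edge_prod (V, w)"
        by (metis imageE prod.collapse)
      then obtain A B where AB: "V = {1..n}" "A \<inter> B = {}" "A \<union> B = {1..n}"
        "\<forall>e\<in>nsets A 2. w e = a - 1" "\<forall>e\<in>nsets B 2. w e = a" "\<forall>u\<in>A. \<forall>v\<in>B. w {u, v} = a + 1"
        unfolding turan_graphs_two_iff by blast
      have "card A \<le> n" using AB card_mono[of "{1..n}" A] by auto
      moreover have "p = turan_size_prod a n (card A)"
        using eq[OF AB(2-6)] G AB by simp
      ultimately show "p \<in> turan_size_prod a n ` {..n}" by blast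
    qed
    show "turan_size_prod a n ` {..n} \<subseteq> edge_prod ` turan_graphs 2 1 a n"
    proof
      fix p assume "p \<in> turan_size_prod a n ` {..n}"
      then obtain k where k: "k \<le> n" "p = turan_size_prod a n k" by auto
      let ?A = "{1..k}" and ?B = "{k<..n}"
      \<comment> \<open>The restricted abstraction makes \<open>w\<close> undefined off the pairs,
        as \<open>multigraph\<close> requires.\<close>
      define w where "w = (\<lambda>e\<in>nsets {1..n} 2.
        if e \<subseteq> ?A then a - 1 else if e \<subseteq> ?B then a else a + 1)"
      have AB: "?A \<inter> ?B = {}" "?A \<union> ?B = {1..n}" using k by auto
      have sub: "nsets ?A 2 \<subseteq> nsets {1..n} 2" "nsets ?B 2 \<subseteq> nsets {1..n} 2"
        using k by (auto intro!: nsets_mono)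
      have wA: "\<forall>e\<in>nsets ?A 2. w e = a - 1"
        using sub by (auto simp: w_def nsets_def)
      have wB: "\<forall>e\<in>nsets ?B 2. w e = a"
        using sub by (auto simp: w_def elim!: nsets2_E)
      have wAB: "\<forall>u\<in>?A. \<forall>v\<in>?B. w {u, v} = a + 1"
        using k by (auto simp: w_def doubleton_in_nsets_2)
      have "multigraph ({1..n}, w)" by (simp add: multigraph_def w_def)
      then have "({1..n}, w) \<in> turan_graphs 2 1 a n"
        unfolding turan_graphs_two_iff using AB wA wB wAB by blast
      moreover have "edge_prod ({1..n}, w) = p"
        using eq[OF AB wA wB wAB] AB(2) k by simp
      ultimately show "p \<in> edge_prod ` turan_graphs 2 1 a n" by blast
    qed
  qed
qed

text \<open>A 7-set with \<open>i\<close> vertices in \<open>A\<close> weighs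
  \<open>i * (7 - i) - (i choose 2)\<close> above \<open>21 * a\<close>; the maximum 9 is attained
  at \<open>i = 2\<close> and \<open>i = 3\<close>.\<close>

lemma turan_graphs_subset_sq_graphs:
  assumes "a \<ge> 1"
  shows "turan_graphs 2 1 a n \<subseteq> sq_graphs n 7 ((7 choose 2) * a + 9)"
proof
  fix G assume T: "G \<in> turan_graphs 2 1 a n"
  obtain V w where Vw: "G = (V, w)" by (cases G)
  from T obtain A B where G: "multigraph (V, w)" "V = {1..n}"
    and AB: "A \<inter> B = {}" "A \<union> B = {1..n}" and w: "\<forall>e\<in>nsets A 2. w e = a - 1"
      "\<forall>e\<in>nsets B 2. w e = a" "\<forall>u\<in>A. \<forall>v\<in>B. w {u, v} = a + 1"
    unfolding Vw turan_graphs_two_iff by blast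
  have "edge_sum (V, w) X \<le> (7 choose 2) * a + 9" if X: "X \<in> nsets {1..n} 7" for X
  proof -
    let ?A = "X \<inter> A" and ?B = "X \<inter> B"
    have fin: "finite ?A" "finite ?B" and disj: "?A \<inter> ?B = {}" and un: "?A \<union> ?B = X"
      using X AB by (auto simp: nsets_def)
    define i where "i = card ?A"
    have "card ?A + card ?B = 7"
      using card_Un_disjoint[OF fin disj] X un by (simp add: nsets_def)
    then have cB: "card ?B = 7 - i" and i: "i \<in> {0, 1, 2, 3, 4, 5, 6, 7}"
      by (auto simp: i_def)
    have "edge_sum (V, w) X = (\<Sum>e\<in>nsets ?A 2. w e) + (\<Sum>e\<in>nsets ?B 2. w e)
        + (\<Sum>(u, v)\<in>?A \<times> ?B. w {u, v})"
      using sum.nsets_two_partition[OF fin disj, of w] un by (simp add: edge_sum_def)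
    also have "\<dots> = (\<Sum>e\<in>nsets ?A 2. a - 1) + (\<Sum>e\<in>nsets ?B 2. a)
        + (\<Sum>(u, v)\<in>?A \<times> ?B. a + 1)"
    proof -
      have "nsets ?A 2 \<subseteq> nsets A 2" "nsets ?B 2 \<subseteq> nsets B 2" by (auto intro!: nsets_mono)
      then show ?thesis
        using w by (intro arg_cong2[where f = "(+)"] sum.cong) auto
    qed
    also have "\<dots> = (i choose 2) * (a - 1) + ((7 - i) choose 2) * a + i * (7 - i) * (a + 1)"
      using fin by (simp add: card_nsets_two card_cartesian_product cB i_def[symmetric]
          case_prod_unfold)
    also have "\<dots> \<le> (7 choose 2) * a + 9"
      using i assms by (auto simp: choose_two)
    finally show ?thesis .
  qed
  then show "G \<in> sq_graphs n 7 ((7 choose 2) * a + 9)"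
    using G Vw by (simp add: sq_graphs_def)
qed

lemma edge_prod_le_turan_size_prod:
  assumes a: "a \<ge> 2" and n: "n \<ge> 15 * 230 ^ 2 + 230"
    and G: "G \<in> sq_graphs n 7 ((7 choose 2) * a + 9)"
  shows "\<exists>k\<le>n. edge_prod G \<le> turan_size_prod a n k"
proof -
  obtain w where w: "G = ({1..n}, w)"
    using G by (cases G) (auto simp: sq_graphs_def)
  have "pair_sum (surplus a w) X \<le> 9" if X: "X \<subseteq> {1..n}" "card X = 7" for X
  proof -
    have fX: "finite X" using X finite_subset by blast
    have "(\<Sum>e\<in>nsets X 2. w e) \<le> (7 choose 2) * a + 9"
      using G X fX by (auto simp: w sq_graphs_def edge_sum_def nsets_def)
    then have "(\<Sum>e\<in>nsets X 2. int (w e)) \<le> int ((7 choose 2) * a + 9)"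
      by (metis of_nat_le_iff of_nat_sum)
    then show ?thesis
      using card_nsets_two[OF fX] X by (simp add: pair_sum_def surplus_def sum_subtractf)
  qed
  then obtain k where k: "k \<le> n" "norm_prod a w {1..n} \<le> turan_ratio a n k"
    using norm_prod_le_turan[OF a, of "{1..n}" w] n by auto
  have "real (edge_prod G) = norm_prod a w {1..n} * real a ^ (n choose 2)"
    using a by (simp add: w edge_prod_def norm_prod_def prod_dividef card_nsets_two)
  also have "\<dots> \<le> turan_ratio a n k * real a ^ (n choose 2)"
    using k by (intro mult_right_mono) auto
  also have "\<dots> = real (turan_size_prod a n k)"
    using turan_size_prod_eq a k by simp
  finally show ?thesis using k(1) of_nat_le_iff by blast
qed

theorem theorem3p8:
  "\<exists>N\<^sub>0::nat. \<forall>a::nat. \<forall>n::nat. a \<ge> 2 \<longrightarrow> n \<ge> N\<^sub>0 \<longrightarrow>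
    ex_prod n 7 ((7 choose 2) * a + 9) = turan_prod 2 1 a n"
proof (intro exI allI impI)
  fix a n :: nat
  \<comment> \<open>This assumption fixes the witness for \<open>N\<^sub>0\<close>, which does not
    depend on \<open>a\<close>.\<close>
  assume a: "a \<ge> 2" and n: "n \<ge> 15 * 230 ^ 2 + 230"
  let ?F = "edge_prod ` sq_graphs n 7 ((7 choose 2) * a + 9)"
  let ?T = "turan_size_prod a n ` {..n}"
  have T: "turan_prod 2 1 a n = Max ?T"
    by (simp only: turan_prod_def edge_prod_turan_graphs)
  have le: "p \<le> Max ?T" if "p \<in> ?F" for p
    using that edge_prod_le_turan_size_prod[OF a n] by (fastforce simp: Max_ge_iff)
  have "?T \<subseteq> ?F"
    unfolding edge_prod_turan_graphs[symmetric]
    using turan_graphs_subset_sq_graphs[of a n] a by (intro image_mono) auto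
  moreover have "Max ?T \<in> ?T" by (intro Max_in) auto
  ultimately have "Max ?T \<in> ?F" by blast
  \<comment> \<open>\<open>Max\<close> is meaningful only on a finite set; the uniform bound
    \<open>le\<close> supplies finiteness.\<close>
  moreover have "finite ?F"
    using le by (intro finite_subset[of ?F "{..Max ?T}"]) auto
  ultimately show "ex_prod n 7 ((7 choose 2) * a + 9) = turan_prod 2 1 a n"
    unfolding T ex_prod_def using le by (intro Max_eqI) auto
qed

end
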